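(* The proof system $\mathsf{MLSR}$ (with nominals, announcement modalities and the existential modality) is complete for validity: every formula of hybrid $\mathsf{MLSR}$ that is valid in the semantics below is derivable in the proof system $\mathsf{MLSR}$.
   Context: Fix a countable set of proposition letters $\mathsf{PROP}$ and a countable set of nominals $\mathsf{NOM}$. Formulas: $\varphi ::= p\mid \mathsf{n}\mid\top\mid\neg\varphi\mid(\varphi\vee\varphi)\mid\Diamond\varphi\mid\langle!\varphi\rangle\varphi\mid\langle-\varphi\rangle\varphi\mid\mathsf{E}\varphi$ ($p\in\mathsf{PROP}$, $\mathsf{n}\in\mathsf{NOM}$); $\Box,[!\varphi],[-\varphi],\mathsf{U}$ are the duals, $\wedge,\rightarrow,\leftrightarrow,\bot$ as usual. Semantics: a model is $\mathcal{M}=(W,R,V)$ with $R\subseteq W\times W$, $V(p)\subseteq W$, and $V(\mathsf{n})\subseteq W$ having at most one element (nominals may fail to denote). For $D\subseteq W$, $\mathcal{M}-D$ is the submodel on $W\setminus D$ (relation and valuation restricted); $\mathcal{M}|\varphi$ is the submodel on $\{t:\mathcal{M},t\models\varphi\}$. $\mathcal{M},s\models p$ iff $s\in V(p)$, likewise for nominals; $\top$ is always true; Booleans standard; $\mathcal{M},s\models\Diamond\varphi$ iff $Rst$ and $\mathcal{M},t\models\varphi$ for some $t$; $\mathcal{M},s\models\mathsf{E}\varphi$ iff $\mathcal{M},t\models\varphi$ for some $t\in W$; $\mathcal{M},s\models\langle!\varphi\rangle\psi$ iff $\mathcal{M},s\models\varphi$ and $\mathcal{M}|\varphi,s\models\psi$;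 $\mathcal{M},s\models\langle-\varphi\rangle\psi$ iff there is $t\neq s$ in $W$ with $\mathcal{M},t\models\varphi$ and $\mathcal{M}-\{t\},s\models\psi$. Valid = true at every point of every model. Proof system $\mathsf{MLSR}$: (1) Replacement of provable equivalents: from $\varphi\leftrightarrow\psi$ infer $\alpha\leftrightarrow\alpha'$ where $\alpha'$ results from replacing an occurrence of $\varphi$ in $\alpha$ by $\psi$ (anywhere, including inside modalities); (2) all propositional tautologies and Modus Ponens; (3) the K axiom and necessitation rule for each box modality $\Box$, $\mathsf{U}$, $[!\varphi]$, $[-\varphi]$; (4) S5 axioms for $\mathsf{U}$ and $\mathsf{U}\varphi\rightarrow\Box\varphi$; (5) announcement axioms: $\langle!\varphi\rangle p\leftrightarrow(\varphi\wedge p)$, $\langle!\varphi\rangle\mathsf{n}\leftrightarrow(\varphi\wedge\mathsf{n})$, $\langle!\varphi\rangle\top\leftrightarrow\varphi$, $\langle!\varphi\rangle\neg\psi\leftrightarrow(\varphi\wedge\neg\langle!\varphi\rangle\psi)$, $\langle!\varphi\rangle(\psi\vee\alpha)\leftrightarrow(\langle!\varphi\rangle\psi\vee\langle!\varphi\rangle\alpha)$, $\langle!\varphi\rangle\Diamond\psi\leftrightarrow(\varphi\wedge\Diamond\langle!\varphi\rangle\psi)$, $\langle!\varphi\rangle\langle!\psi\rangle\alpha\leftrightarrow\langle!(\varphi\wedge[!\varphi]\psi)\rangle\alpha$, $\langle!\varphi\rangle\mathsf{E}\psi\leftrightarrow(\varphi\wedge\mathsf{E}\langle!\varphi\rangle\psi)$;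 (6) Truth Axiom $\langle!\top\rangle\varphi\leftrightarrow\varphi$; (7) axiom (H): $\mathsf{E}(\mathsf{n}\wedge\varphi)\rightarrow\mathsf{U}(\mathsf{n}\rightarrow\varphi)$; (8) Name rule: from $\mathsf{m}\rightarrow\varphi$ infer $\varphi$, if $\mathsf{m}$ does not occur in $\varphi$; (9) Paste rule: for $\nabla\in\{\Diamond,\mathsf{E}\}$, from $(\mathsf{E}(\mathsf{n}\wedge\nabla\mathsf{m})\wedge\mathsf{E}(\mathsf{m}\wedge\varphi))\rightarrow\sigma$ infer $\mathsf{E}(\mathsf{n}\wedge\nabla\varphi)\rightarrow\sigma$, if $\mathsf{m}$ does not occur in $\varphi,\sigma$; (10) Mix Axiom: $(\mathsf{E}(\mathsf{n}\wedge\alpha)\wedge\langle!\neg\mathsf{n}\rangle\varphi)\rightarrow\langle-\alpha\rangle\varphi$; (11) Mix Rule: from $\mathsf{E}(\mathsf{n}\wedge\langle!\varphi\rangle(\mathsf{E}(\mathsf{k}\wedge\alpha)\wedge\langle!\neg\mathsf{k}\rangle\psi))\rightarrow\sigma$ infer $\mathsf{E}(\mathsf{n}\wedge\langle!\varphi\rangle\langle-\alpha\rangle\psi)\rightarrow\sigma$, if $\mathsf{k}$ does not occur in $\varphi,\alpha,\psi,\sigma$. *)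

theory Defs
  imports Main "HOL-Library.Countable"
begin

section \<open>Formulas\<close>

datatype (props: 'p, noms: 'n) form =
    Prop 'p
  | Nom 'n
  | Top  (\<open>\<^bold>\<top>\<close>)
  | Neg "('p, 'n) form"  (\<open>\<^bold>\<not> _\<close> [70] 70)
  | Or "('p, 'n) form" "('p, 'n) form"  (infixr \<open>\<^bold>\<or>\<close> 62)
  | Dia "('p, 'n) form"  (\<open>\<^bold>\<diamond> _\<close> [70] 70)
  | Ann "('p, 'n) form" "('p, 'n) form"  (\<open>\<langle>!_\<rangle> _\<close> [0, 70] 70)
  | Rem "('p, 'n) form" "('p, 'n) form"  (\<open>\<langle>-_\<rangle> _\<close> [0, 70] 70)
  | Ex "('p, 'n) form"  (\<open>\<^bold>E _\<close> [70] 70)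

abbreviation Bot :: "('p, 'n) form"  (\<open>\<^bold>\<bottom>\<close>)
  where "\<^bold>\<bottom> \<equiv> \<^bold>\<not> \<^bold>\<top>"

abbreviation And :: "('p, 'n) form \<Rightarrow> ('p, 'n) form \<Rightarrow> ('p, 'n) form"  (infixr \<open>\<^bold>\<and>\<close> 65)
  where "\<phi> \<^bold>\<and> \<psi> \<equiv> \<^bold>\<not> (\<^bold>\<not> \<phi> \<^bold>\<or> \<^bold>\<not> \<psi>)"

abbreviation Imp :: "('p, 'n) form \<Rightarrow> ('p, 'n) form \<Rightarrow> ('p, 'n) form"  (infixr \<open>\<^bold>\<rightarrow>\<close> 58)
  where "\<phi> \<^bold>\<rightarrow> \<psi> \<equiv> \<^bold>\<not> \<phi> \<^bold>\<or> \<psi>"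

abbreviation Iff :: "('p, 'n) form \<Rightarrow> ('p, 'n) form \<Rightarrow> ('p, 'n) form"  (infix \<open>\<^bold>\<leftrightarrow>\<close> 55)
  where "\<phi> \<^bold>\<leftrightarrow> \<psi> \<equiv> (\<phi> \<^bold>\<rightarrow> \<psi>) \<^bold>\<and> (\<psi> \<^bold>\<rightarrow> \<phi>)"

abbreviation Box :: "('p, 'n) form \<Rightarrow> ('p, 'n) form"  (\<open>\<^bold>\<box> _\<close> [70] 70)
  where "\<^bold>\<box> \<phi> \<equiv> \<^bold>\<not> \<^bold>\<diamond> \<^bold>\<not> \<phi>"

abbreviation BoxAnn :: "('p, 'n) form \<Rightarrow> ('p, 'n) form \<Rightarrow> ('p, 'n) form"  (\<open>\<^bold>[!_\<^bold>] _\<close> [0, 70] 70)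
  where "\<^bold>[!\<phi>\<^bold>] \<psi> \<equiv> \<^bold>\<not> \<langle>!\<phi>\<rangle> \<^bold>\<not> \<psi>"

abbreviation BoxRem :: "('p, 'n) form \<Rightarrow> ('p, 'n) form \<Rightarrow> ('p, 'n) form"  (\<open>\<^bold>[-_\<^bold>] _\<close> [0, 70] 70)
  where "\<^bold>[-\<phi>\<^bold>] \<psi> \<equiv> \<^bold>\<not> \<langle>-\<phi>\<rangle> \<^bold>\<not> \<psi>"

abbreviation Univ :: "('p, 'n) form \<Rightarrow> ('p, 'n) form"  (\<open>\<^bold>U _\<close> [70] 70)
  where "\<^bold>U \<phi> \<equiv> \<^bold>\<not> \<^bold>E \<^bold>\<not> \<phi>"


section \<open>Semantics\<close>

record ('w, 'p, 'n) model =
  worlds :: "'w set"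
  rel :: "('w \<times> 'w) set"
  valP :: "'p \<Rightarrow> 'w set"
  valN :: "'n \<Rightarrow> 'w set"

definition is_model :: "('w, 'p, 'n) model \<Rightarrow> bool" where
  "is_model M \<longleftrightarrow>
     rel M \<subseteq> worlds M \<times> worlds M \<and>
     (\<forall>p. valP M p \<subseteq> worlds M) \<and>
     (\<forall>n. valN M n \<subseteq> worlds M \<and> (\<forall>s \<in> valN M n. \<forall>t \<in> valN M n. s = t))"

definition submodel :: "('w, 'p, 'n) model \<Rightarrow> 'w set \<Rightarrow> ('w, 'p, 'n) model" where
  "submodel M D =
     \<lparr> worlds = worlds M \<inter> D,
       rel = rel M \<inter> (D \<times> D),
       valP = (\<lambda>p. valP M p \<inter> D),
       valN = (\<lambda>n. valN M n \<inter> D) \<rparr>"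

definition remove :: "('w, 'p, 'n) model \<Rightarrow> 'w set \<Rightarrow> ('w, 'p, 'n) model" where
  "remove M D = submodel M (worlds M - D)"

primrec sat :: "('w, 'p, 'n) model \<Rightarrow> 'w \<Rightarrow> ('p, 'n) form \<Rightarrow> bool"
    (\<open>_, _ \<Turnstile> _\<close> [51, 51, 51] 50) where
  "(M, s \<Turnstile> Prop p) \<longleftrightarrow> s \<in> valP M p"
| "(M, s \<Turnstile> Nom n) \<longleftrightarrow> s \<in> valN M n"
| "(M, s \<Turnstile> \<^bold>\<top>) \<longleftrightarrow> True"
| "(M, s \<Turnstile> \<^bold>\<not> \<phi>) \<longleftrightarrow> \<not> (M, s \<Turnstile> \<phi>)"
| "(M, s \<Turnstile> \<phi> \<^bold>\<or> \<psi>) \<longleftrightarrow> (M, s \<Turnstile> \<phi>) \<or> (M, s \<Turnstile> \<psi>)"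
| "(M, s \<Turnstile> \<^bold>\<diamond> \<phi>) \<longleftrightarrow> (\<exists>t. (s, t) \<in> rel M \<and> (M, t \<Turnstile> \<phi>))"
| "(M, s \<Turnstile> \<langle>!\<phi>\<rangle> \<psi>) \<longleftrightarrow>
     (M, s \<Turnstile> \<phi>) \<and> (submodel M {t \<in> worlds M. M, t \<Turnstile> \<phi>}, s \<Turnstile> \<psi>)"
| "(M, s \<Turnstile> \<langle>-\<phi>\<rangle> \<psi>) \<longleftrightarrow>
     (\<exists>t \<in> worlds M. t \<noteq> s \<and> (M, t \<Turnstile> \<phi>) \<and> (remove M {t}, s \<Turnstile> \<psi>))"
| "(M, s \<Turnstile> \<^bold>E \<phi>) \<longleftrightarrow> (\<exists>t \<in> worlds M. M, t \<Turnstile> \<phi>)"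

text \<open>
  HOL cannot quantify over types inside a formula, so validity is relative to a type
  \<open>'w\<close> from which the worlds of all models are drawn; the carrier of a model is an
  arbitrary subset of that type.
\<close>

definition valid :: "'w itself \<Rightarrow> ('p, 'n) form \<Rightarrow> bool" where
  "valid _ \<phi> \<longleftrightarrow>
     (\<forall>M :: ('w, 'p, 'n) model. is_model M \<longrightarrow> (\<forall>s \<in> worlds M. M, s \<Turnstile> \<phi>))"


section \<open>The proof system MLSR\<close>

text \<open>
  Propositional tautologies: the modal formulas and the atoms are evaluated by an
  arbitrary \<open>v\<close>, so the tautologies are all substitution instances of classical ones.
\<close>

fun peval :: "(('p, 'n) form \<Rightarrow> bool) \<Rightarrow> ('p, 'n) form \<Rightarrow> bool" where
  "peval v \<^bold>\<top> \<longleftrightarrow> True"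
| "peval v (\<^bold>\<not> \<phi>) \<longleftrightarrow> \<not> peval v \<phi>"
| "peval v (\<phi> \<^bold>\<or> \<psi>) \<longleftrightarrow> peval v \<phi> \<or> peval v \<psi>"
| "peval v \<phi> \<longleftrightarrow> v \<phi>"

definition tautology :: "('p, 'n) form \<Rightarrow> bool" where
  "tautology \<phi> \<longleftrightarrow> (\<forall>v. peval v \<phi>)"

text \<open>
  \<open>replaces \<phi> \<psi> \<alpha> \<alpha>'\<close>: \<open>\<alpha>'\<close> arises from \<open>\<alpha>\<close> by replacing exactly one occurrence of \<open>\<phi>\<close> by \<open>\<psi>\<close>.
\<close>

inductive replaces ::
    "('p, 'n) form \<Rightarrow> ('p, 'n) form \<Rightarrow> ('p, 'n) form \<Rightarrow> ('p, 'n) form \<Rightarrow> bool"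
  for \<phi> \<psi> where
  here: "replaces \<phi> \<psi> \<phi> \<psi>"
| Neg: "replaces \<phi> \<psi> \<alpha> \<alpha>' \<Longrightarrow> replaces \<phi> \<psi> (\<^bold>\<not> \<alpha>) (\<^bold>\<not> \<alpha>')"
| Or_left: "replaces \<phi> \<psi> \<alpha> \<alpha>' \<Longrightarrow> replaces \<phi> \<psi> (\<alpha> \<^bold>\<or> \<beta>) (\<alpha>' \<^bold>\<or> \<beta>)"
| Or_right: "replaces \<phi> \<psi> \<alpha> \<alpha>' \<Longrightarrow> replaces \<phi> \<psi> (\<beta> \<^bold>\<or> \<alpha>) (\<beta> \<^bold>\<or> \<alpha>')"
| Dia: "replaces \<phi> \<psi> \<alpha> \<alpha>' \<Longrightarrow> replaces \<phi> \<psi> (\<^bold>\<diamond> \<alpha>) (\<^bold>\<diamond> \<alpha>')"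
| Ann_left: "replaces \<phi> \<psi> \<alpha> \<alpha>' \<Longrightarrow> replaces \<phi> \<psi> (\<langle>!\<alpha>\<rangle> \<beta>) (\<langle>!\<alpha>'\<rangle> \<beta>)"
| Ann_right: "replaces \<phi> \<psi> \<alpha> \<alpha>' \<Longrightarrow> replaces \<phi> \<psi> (\<langle>!\<beta>\<rangle> \<alpha>) (\<langle>!\<beta>\<rangle> \<alpha>')"
| Rem_left: "replaces \<phi> \<psi> \<alpha> \<alpha>' \<Longrightarrow> replaces \<phi> \<psi> (\<langle>-\<alpha>\<rangle> \<beta>) (\<langle>-\<alpha>'\<rangle> \<beta>)"
| Rem_right: "replaces \<phi> \<psi> \<alpha> \<alpha>' \<Longrightarrow> replaces \<phi> \<psi> (\<langle>-\<beta>\<rangle> \<alpha>) (\<langle>-\<beta>\<rangle> \<alpha>')"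
| Ex: "replaces \<phi> \<psi> \<alpha> \<alpha>' \<Longrightarrow> replaces \<phi> \<psi> (\<^bold>E \<alpha>) (\<^bold>E \<alpha>')"

text \<open>
  In the Paste and Mix rules the fresh nominal must also differ from the nominal \<open>n\<close>
  of the conclusion; without this the rules are unsound.  For example, with \<open>k = n\<close> the
  premise of the Mix rule has an unsatisfiable antecedent and so holds for every \<open>\<sigma>\<close>.
\<close>

inductive derivable :: "('p, 'n) form \<Rightarrow> bool"  (\<open>\<turnstile> _\<close> [51] 50) where
  Replacement: "\<turnstile> \<phi> \<^bold>\<leftrightarrow> \<psi> \<Longrightarrow> replaces \<phi> \<psi> \<alpha> \<alpha>' \<Longrightarrow> \<turnstile> \<alpha> \<^bold>\<leftrightarrow> \<alpha>'"

| Taut: "tautology \<phi> \<Longrightarrow> \<turnstile> \<phi>"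
| MP: "\<turnstile> \<phi> \<^bold>\<rightarrow> \<psi> \<Longrightarrow> \<turnstile> \<phi> \<Longrightarrow> \<turnstile> \<psi>"

| K_Box: "\<turnstile> \<^bold>\<box> (\<phi> \<^bold>\<rightarrow> \<psi>) \<^bold>\<rightarrow> (\<^bold>\<box> \<phi> \<^bold>\<rightarrow> \<^bold>\<box> \<psi>)"
| K_U: "\<turnstile> \<^bold>U (\<phi> \<^bold>\<rightarrow> \<psi>) \<^bold>\<rightarrow> (\<^bold>U \<phi> \<^bold>\<rightarrow> \<^bold>U \<psi>)"
| K_Ann: "\<turnstile> \<^bold>[!\<alpha>\<^bold>] (\<phi> \<^bold>\<rightarrow> \<psi>) \<^bold>\<rightarrow> (\<^bold>[!\<alpha>\<^bold>] \<phi> \<^bold>\<rightarrow> \<^bold>[!\<alpha>\<^bold>] \<psi>)"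
| K_Rem: "\<turnstile> \<^bold>[-\<alpha>\<^bold>] (\<phi> \<^bold>\<rightarrow> \<psi>) \<^bold>\<rightarrow> (\<^bold>[-\<alpha>\<^bold>] \<phi> \<^bold>\<rightarrow> \<^bold>[-\<alpha>\<^bold>] \<psi>)"
| Nec_Box: "\<turnstile> \<phi> \<Longrightarrow> \<turnstile> \<^bold>\<box> \<phi>"
| Nec_U: "\<turnstile> \<phi> \<Longrightarrow> \<turnstile> \<^bold>U \<phi>"
| Nec_Ann: "\<turnstile> \<phi> \<Longrightarrow> \<turnstile> \<^bold>[!\<alpha>\<^bold>] \<phi>"
| Nec_Rem: "\<turnstile> \<phi> \<Longrightarrow> \<turnstile> \<^bold>[-\<alpha>\<^bold>] \<phi>"

| U_T: "\<turnstile> \<^bold>U \<phi> \<^bold>\<rightarrow> \<phi>"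
| U_4: "\<turnstile> \<^bold>U \<phi> \<^bold>\<rightarrow> \<^bold>U \<^bold>U \<phi>"
| U_5: "\<turnstile> \<^bold>E \<phi> \<^bold>\<rightarrow> \<^bold>U \<^bold>E \<phi>"
| U_Box: "\<turnstile> \<^bold>U \<phi> \<^bold>\<rightarrow> \<^bold>\<box> \<phi>"

| Ann_Prop: "\<turnstile> \<langle>!\<phi>\<rangle> Prop p \<^bold>\<leftrightarrow> \<phi> \<^bold>\<and> Prop p"
| Ann_Nom: "\<turnstile> \<langle>!\<phi>\<rangle> Nom n \<^bold>\<leftrightarrow> \<phi> \<^bold>\<and> Nom n"
| Ann_Top: "\<turnstile> \<langle>!\<phi>\<rangle> \<^bold>\<top> \<^bold>\<leftrightarrow> \<phi>"
| Ann_Neg: "\<turnstile> \<langle>!\<phi>\<rangle> \<^bold>\<not> \<psi> \<^bold>\<leftrightarrow> \<phi> \<^bold>\<and> \<^bold>\<not> \<langle>!\<phi>\<rangle> \<psi>"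
| Ann_Or: "\<turnstile> \<langle>!\<phi>\<rangle> (\<psi> \<^bold>\<or> \<alpha>) \<^bold>\<leftrightarrow> \<langle>!\<phi>\<rangle> \<psi> \<^bold>\<or> \<langle>!\<phi>\<rangle> \<alpha>"
| Ann_Dia: "\<turnstile> \<langle>!\<phi>\<rangle> \<^bold>\<diamond> \<psi> \<^bold>\<leftrightarrow> \<phi> \<^bold>\<and> \<^bold>\<diamond> \<langle>!\<phi>\<rangle> \<psi>"
| Ann_Ann: "\<turnstile> \<langle>!\<phi>\<rangle> \<langle>!\<psi>\<rangle> \<alpha> \<^bold>\<leftrightarrow> \<langle>!\<phi> \<^bold>\<and> \<^bold>[!\<phi>\<^bold>] \<psi>\<rangle> \<alpha>"
| Ann_Ex: "\<turnstile> \<langle>!\<phi>\<rangle> \<^bold>E \<psi> \<^bold>\<leftrightarrow> \<phi> \<^bold>\<and> \<^bold>E \<langle>!\<phi>\<rangle> \<psi>"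

| Truth: "\<turnstile> \<langle>!\<^bold>\<top>\<rangle> \<phi> \<^bold>\<leftrightarrow> \<phi>"

| H: "\<turnstile> \<^bold>E (Nom n \<^bold>\<and> \<phi>) \<^bold>\<rightarrow> \<^bold>U (Nom n \<^bold>\<rightarrow> \<phi>)"

| Name: "\<turnstile> Nom m \<^bold>\<rightarrow> \<phi> \<Longrightarrow> m \<notin> noms \<phi> \<Longrightarrow> \<turnstile> \<phi>"

| Paste_Dia: "\<turnstile> \<^bold>E (Nom n \<^bold>\<and> \<^bold>\<diamond> Nom m) \<^bold>\<and> \<^bold>E (Nom m \<^bold>\<and> \<phi>) \<^bold>\<rightarrow> \<sigma> \<Longrightarrow>
    m \<noteq> n \<Longrightarrow> m \<notin> noms \<phi> \<union> noms \<sigma> \<Longrightarrow> \<turnstile> \<^bold>E (Nom n \<^bold>\<and> \<^bold>\<diamond> \<phi>) \<^bold>\<rightarrow> \<sigma>"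
| Paste_Ex: "\<turnstile> \<^bold>E (Nom n \<^bold>\<and> \<^bold>E Nom m) \<^bold>\<and> \<^bold>E (Nom m \<^bold>\<and> \<phi>) \<^bold>\<rightarrow> \<sigma> \<Longrightarrow>
    m \<noteq> n \<Longrightarrow> m \<notin> noms \<phi> \<union> noms \<sigma> \<Longrightarrow> \<turnstile> \<^bold>E (Nom n \<^bold>\<and> \<^bold>E \<phi>) \<^bold>\<rightarrow> \<sigma>"

| Mix_Axiom: "\<turnstile> \<^bold>E (Nom n \<^bold>\<and> \<alpha>) \<^bold>\<and> \<langle>!\<^bold>\<not> Nom n\<rangle> \<phi> \<^bold>\<rightarrow> \<langle>-\<alpha>\<rangle> \<phi>"
| Mix_Rule:
    "\<turnstile> \<^bold>E (Nom n \<^bold>\<and> \<langle>!\<phi>\<rangle> (\<^bold>E (Nom k \<^bold>\<and> \<alpha>) \<^bold>\<and> \<langle>!\<^bold>\<not> Nom k\<rangle> \<psi>)) \<^bold>\<rightarrow> \<sigma> \<Longrightarrow>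
     k \<noteq> n \<Longrightarrow> k \<notin> noms \<phi> \<union> noms \<alpha> \<union> noms \<psi> \<union> noms \<sigma> \<Longrightarrow>
     \<turnstile> \<^bold>E (Nom n \<^bold>\<and> \<langle>!\<phi>\<rangle> \<langle>-\<alpha>\<rangle> \<psi>) \<^bold>\<rightarrow> \<sigma>"

end

theory Submission
  imports Defs
begin

text \<open>
  Henkin-style completeness. A consistent formula extends to a maximal consistent set \<open>\<Gamma>\<close> in
  which the Paste and Mix rules have witnessing nominals; the worlds of the canonical model are
  the denoting nominals of \<open>\<Gamma>\<close>, up to provable identity, and each carries the maximal consistent
  set \<open>{\<chi>. \<^bold>E (Nom n \<^bold>\<and> \<chi>) \<in> \<Gamma>}\<close>. There is no reduction axiom for
  \<open>\<langle>-\<alpha>\<rangle>\<close>, so the truth lemma is proved relative to an announcement: by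
  induction on \<open>\<psi>\<close>, for all \<open>\<phi>\<close> at once, \<open>\<langle>!\<phi>\<rangle> \<psi>\<close> lies in the set at \<open>n\<close> iff \<open>\<phi>\<close> does and \<open>\<psi>\<close> holds
  at \<open>n\<close> in the submodel cut out by \<open>\<phi>\<close>. Deleting the world named \<open>k\<close> is then the announcement of
  \<open>\<^bold>\<not> Nom k\<close>, absorbed into \<open>\<phi>\<close> by the composition axiom. The Truth axiom transfers the case
  \<open>\<phi> = \<^bold>\<top>\<close> to the whole model.
\<close>

section \<open>Derived rules\<close>

instance form :: (countable, countable) countable
  by countable_datatype

lemma finite_noms: "finite (noms \<phi>)"
  by (induction \<phi>) auto

lemma derivable_taut_mp:
  assumes "tautology (\<phi> \<^bold>\<rightarrow> \<psi>)" "\<turnstile> \<phi>"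
  shows "\<turnstile> \<psi>"
  using assms Taut MP by blast

lemma derivable_taut_mp2:
  assumes "tautology (\<phi> \<^bold>\<rightarrow> \<psi> \<^bold>\<rightarrow> \<chi>)" "\<turnstile> \<phi>" "\<turnstile> \<psi>"
  shows "\<turnstile> \<chi>"
  using assms Taut MP by blast

lemma Imp_trans: "\<turnstile> \<phi> \<^bold>\<rightarrow> \<psi> \<Longrightarrow> \<turnstile> \<psi> \<^bold>\<rightarrow> \<chi> \<Longrightarrow> \<turnstile> \<phi> \<^bold>\<rightarrow> \<chi>"
  by (rule derivable_taut_mp2[rotated], assumption+) (auto simp: tautology_def)

lemma Neg_Neg_Iff: "\<turnstile> \<^bold>\<not> \<^bold>\<not> \<phi> \<^bold>\<leftrightarrow> \<phi>"
  by (rule Taut) (auto simp: tautology_def)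

lemma Imp_contrapos: "\<turnstile> \<phi> \<^bold>\<rightarrow> \<psi> \<Longrightarrow> \<turnstile> \<^bold>\<not> \<psi> \<^bold>\<rightarrow> \<^bold>\<not> \<phi>"
  by (rule derivable_taut_mp[rotated], assumption) (auto simp: tautology_def)

lemma Ex_Neg_Neg_Iff: "\<turnstile> \<^bold>E \<^bold>\<not> \<^bold>\<not> \<phi> \<^bold>\<leftrightarrow> \<^bold>E \<phi>"
  by (rule Replacement[OF Neg_Neg_Iff replaces.Ex[OF replaces.here]])

lemma U_mono: "\<turnstile> \<phi> \<^bold>\<rightarrow> \<psi> \<Longrightarrow> \<turnstile> \<^bold>U \<phi> \<^bold>\<rightarrow> \<^bold>U \<psi>"
  by (rule MP[OF K_U Nec_U])

text \<open>\<open>Univ\<close> abbreviates \<open>Neg\<close>, \<open>Ex\<close>,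
  \<open>Neg\<close> in sequence, so contraposing and applying K leaves double negations under
  \<open>Ex\<close>; Replacement removes them. \<open>Ann_mono\<close> follows the same
  pattern.\<close>

lemma Ex_mono:
  assumes "\<turnstile> \<phi> \<^bold>\<rightarrow> \<psi>"
  shows "\<turnstile> \<^bold>E \<phi> \<^bold>\<rightarrow> \<^bold>E \<psi>"
proof -
  have "\<turnstile> \<^bold>\<not> \<^bold>E \<^bold>\<not> \<^bold>\<not> \<psi> \<^bold>\<rightarrow> \<^bold>\<not> \<^bold>E \<^bold>\<not> \<^bold>\<not> \<phi>"
    by (rule U_mono[OF Imp_contrapos[OF assms]])
  moreover have "\<turnstile> (\<^bold>E \<^bold>\<not> \<^bold>\<not> \<phi> \<^bold>\<leftrightarrow> \<^bold>E \<phi>) \<^bold>\<and> (\<^bold>E \<^bold>\<not> \<^bold>\<not> \<psi> \<^bold>\<leftrightarrow> \<^bold>E \<psi>)"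
    by (rule derivable_taut_mp2[OF _ Ex_Neg_Neg_Iff[of \<phi>] Ex_Neg_Neg_Iff[of \<psi>]])
      (auto simp: tautology_def)
  ultimately show ?thesis
    by (rule derivable_taut_mp2[rotated]) (auto simp: tautology_def)
qed

lemma Ann_mono:
  assumes "\<turnstile> \<phi> \<^bold>\<rightarrow> \<psi>"
  shows "\<turnstile> \<langle>!\<alpha>\<rangle> \<phi> \<^bold>\<rightarrow> \<langle>!\<alpha>\<rangle> \<psi>"
proof -
  have "\<turnstile> \<langle>!\<alpha>\<rangle> \<^bold>\<not> \<^bold>\<not> \<chi> \<^bold>\<leftrightarrow> \<langle>!\<alpha>\<rangle> \<chi>" for \<chi> :: "('a, 'b) form"
    by (rule Replacement[OF Neg_Neg_Iff replaces.Ann_right[OF replaces.here]])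
  from this[of \<phi>] this[of \<psi>]
  have "\<turnstile> (\<langle>!\<alpha>\<rangle> \<^bold>\<not> \<^bold>\<not> \<phi> \<^bold>\<leftrightarrow> \<langle>!\<alpha>\<rangle> \<phi>) \<^bold>\<and> (\<langle>!\<alpha>\<rangle> \<^bold>\<not> \<^bold>\<not> \<psi> \<^bold>\<leftrightarrow> \<langle>!\<alpha>\<rangle> \<psi>)"
    by (rule derivable_taut_mp2[rotated]) (auto simp: tautology_def)
  moreover have "\<turnstile> \<^bold>\<not> \<langle>!\<alpha>\<rangle> \<^bold>\<not> \<^bold>\<not> \<psi> \<^bold>\<rightarrow> \<^bold>\<not> \<langle>!\<alpha>\<rangle> \<^bold>\<not> \<^bold>\<not> \<phi>"
    by (rule MP[OF K_Ann Nec_Ann[OF Imp_contrapos[OF assms]]])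
  ultimately show ?thesis
    by (rule derivable_taut_mp2[rotated]) (auto simp: tautology_def)
qed


section \<open>Maximal consistent sets\<close>

text \<open>Maximal consistency is encoded by its closure properties; both consistency and
  maximality sit in \<open>Neg_iff\<close>.\<close>

locale mcs =
  fixes \<Gamma> :: "('p, 'n) form set"
  assumes derivable: "\<turnstile> \<chi> \<Longrightarrow> \<chi> \<in> \<Gamma>"
    and mp: "(\<chi> \<^bold>\<rightarrow> \<xi>) \<in> \<Gamma> \<Longrightarrow> \<chi> \<in> \<Gamma> \<Longrightarrow> \<xi> \<in> \<Gamma>"
    and Neg_iff: "\<^bold>\<not> \<chi> \<in> \<Gamma> \<longleftrightarrow> \<chi> \<notin> \<Gamma>"
begin

lemma Or_iff: "(\<chi> \<^bold>\<or> \<xi>) \<in> \<Gamma> \<longleftrightarrow> \<chi> \<in> \<Gamma> \<or> \<xi> \<in> \<Gamma>"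
proof
  assume "(\<chi> \<^bold>\<or> \<xi>) \<in> \<Gamma>"
  moreover have "((\<chi> \<^bold>\<or> \<xi>) \<^bold>\<rightarrow> (\<^bold>\<not> \<chi> \<^bold>\<rightarrow> \<xi>)) \<in> \<Gamma>"
    by (rule derivable, rule Taut) (auto simp: tautology_def)
  ultimately show "\<chi> \<in> \<Gamma> \<or> \<xi> \<in> \<Gamma>"
    using mp Neg_iff by blast
next
  have "(\<chi> \<^bold>\<rightarrow> \<chi> \<^bold>\<or> \<xi>) \<in> \<Gamma>" "(\<xi> \<^bold>\<rightarrow> \<chi> \<^bold>\<or> \<xi>) \<in> \<Gamma>"
    by (rule derivable, rule Taut, auto simp: tautology_def)+
  then show "\<chi> \<in> \<Gamma> \<or> \<xi> \<in> \<Gamma> \<Longrightarrow> (\<chi> \<^bold>\<or> \<xi>) \<in> \<Gamma>"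
    using mp by blast
qed

lemma derivable_Imp: "\<turnstile> \<chi> \<^bold>\<rightarrow> \<xi> \<Longrightarrow> \<chi> \<in> \<Gamma> \<Longrightarrow> \<xi> \<in> \<Gamma>"
  using derivable mp by blast

lemma derivable_Iff: "\<turnstile> \<chi> \<^bold>\<leftrightarrow> \<xi> \<Longrightarrow> \<chi> \<in> \<Gamma> \<longleftrightarrow> \<xi> \<in> \<Gamma>"
  using derivable[of "\<chi> \<^bold>\<leftrightarrow> \<xi>"] by (auto simp: Neg_iff Or_iff)

text \<open>By K, a universal \<chi> together with a universal negation of \<zeta> would refute
  \<xi> everywhere. This is the main device for propositional reasoning inside a named
  world.\<close>

lemma U_Ex:
  assumes "\<^bold>U \<chi> \<in> \<Gamma>" "\<^bold>E \<xi> \<in> \<Gamma>" "\<turnstile> \<chi> \<^bold>\<rightarrow> \<xi> \<^bold>\<rightarrow> \<zeta>"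
  shows "\<^bold>E \<zeta> \<in> \<Gamma>"
proof -
  have "\<turnstile> \<chi> \<^bold>\<rightarrow> \<^bold>\<not> \<zeta> \<^bold>\<rightarrow> \<^bold>\<not> \<xi>"
    by (rule derivable_taut_mp[OF _ assms(3)]) (auto simp: tautology_def)
  then have "\<turnstile> \<^bold>U \<chi> \<^bold>\<rightarrow> (\<^bold>U \<^bold>\<not> \<zeta> \<^bold>\<rightarrow> \<^bold>U \<^bold>\<not> \<xi>)"
    by (rule Imp_trans[OF U_mono K_U])
  then have "\<^bold>U \<^bold>\<not> \<zeta> \<in> \<Gamma> \<Longrightarrow> \<^bold>U \<^bold>\<not> \<xi> \<in> \<Gamma>"
    using assms(1) by (metis derivable_Imp mp)
  then show ?thesis
    using assms(2) derivable_Iff[OF Ex_Neg_Neg_Iff] by (auto simp: Neg_iff)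
qed

end


section \<open>Witnessing nominals\<close>

text \<open>The first argument is the antecedent in the conclusion of a Paste rule or the Mix rule;
  the function yields the antecedent of the premise for each candidate nominal. All three rules
  thereby get one shape, with the nominal chosen later.\<close>

inductive witness :: "('p, 'n) form \<Rightarrow> ('n \<Rightarrow> ('p, 'n) form) \<Rightarrow> bool" where
  Dia: "witness (\<^bold>E (Nom n \<^bold>\<and> \<^bold>\<diamond> \<phi>)) (\<lambda>m. \<^bold>E (Nom n \<^bold>\<and> \<^bold>\<diamond> Nom m) \<^bold>\<and> \<^bold>E (Nom m \<^bold>\<and> \<phi>))"
| Ex: "witness (\<^bold>E (Nom n \<^bold>\<and> \<^bold>E \<phi>)) (\<lambda>m. \<^bold>E (Nom n \<^bold>\<and> \<^bold>E Nom m) \<^bold>\<and> \<^bold>E (Nom m \<^bold>\<and> \<phi>))"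
| Rem: "witness (\<^bold>E (Nom n \<^bold>\<and> \<langle>!\<phi>\<rangle> \<langle>-\<alpha>\<rangle> \<psi>))
    (\<lambda>k. \<^bold>E (Nom n \<^bold>\<and> \<langle>!\<phi>\<rangle> (\<^bold>E (Nom k \<^bold>\<and> \<alpha>) \<^bold>\<and> \<langle>!\<^bold>\<not> Nom k\<rangle> \<psi>)))"

lemma witness_unique: "witness \<chi> g \<Longrightarrow> witness \<chi> h \<Longrightarrow> g = h"
  by (auto elim!: witness.cases)

text \<open>The outer nominal \<open>n\<close> occurs in \<chi>, so freshness for \<chi> also
  supplies the side condition that \<open>k\<close> differs from \<open>n\<close>.\<close>

lemma witness_rule:
  assumes "witness \<chi> g" "k \<notin> noms \<chi> \<union> noms \<sigma>" "\<turnstile> g k \<^bold>\<rightarrow> \<sigma>"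
  shows "\<turnstile> \<chi> \<^bold>\<rightarrow> \<sigma>"
  using assms
proof cases
  case (Dia n \<phi>)
  with assms show ?thesis using Paste_Dia[of n k \<phi> \<sigma>] by auto
next
  case (Ex n \<phi>)
  with assms show ?thesis using Paste_Ex[of n k \<phi> \<sigma>] by auto
next
  case (Rem n \<phi> \<alpha> \<psi>)
  with assms show ?thesis using Mix_Rule[of n \<phi> k \<alpha> \<psi> \<sigma>] by auto
qed

section \<open>Lindenbaum construction with fresh witnesses\<close>

definition add_witness :: "('p, 'n) form \<Rightarrow> ('p, 'n) form \<Rightarrow> ('p, 'n) form" where
  "add_witness \<theta> \<chi> =
    (if \<exists>g. witness \<chi> g
     then (THE g. witness \<chi> g) (SOME k. k \<notin> noms (\<theta> \<^bold>\<and> \<chi>)) \<^bold>\<and> (\<theta> \<^bold>\<and> \<chi>) else \<theta> \<^bold>\<and> \<chi>)"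

text \<open>Each stage is a single formula, the conjunction of everything accepted so far, hence
  mentions only finitely many nominals. The enumeration \<open>from_nat\<close> presents every
  formula once its index \<open>to_nat\<close> is reached.\<close>

primrec stage ::
  "('p :: countable, 'n :: countable) form \<Rightarrow> nat \<Rightarrow> ('p, 'n) form" where
  "stage \<theta> 0 = \<theta>"
| "stage \<theta> (Suc i) =
    (if \<turnstile> \<^bold>\<not> (stage \<theta> i \<^bold>\<and> from_nat i) then stage \<theta> i else add_witness (stage \<theta> i) (from_nat i))"

lemma add_witness_eq:
  assumes "witness \<chi> g"
  shows "add_witness \<theta> \<chi> = g (SOME k. k \<notin> noms (\<theta> \<^bold>\<and> \<chi>)) \<^bold>\<and> (\<theta> \<^bold>\<and> \<chi>)"
proof -
  have "(THE g. witness \<chi> g) = g"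
    using assms witness_unique by blast
  then show ?thesis
    using assms by (auto simp: add_witness_def)
qed

lemma add_witness_Imp: "\<turnstile> add_witness \<theta> \<chi> \<^bold>\<rightarrow> \<theta> \<^bold>\<and> \<chi>"
  by (rule Taut) (auto simp: tautology_def add_witness_def)

text \<open>If adding the witness were inconsistent, \<open>g k\<close> would imply the negation of
  \<theta> and \<chi>. With that negation as \<sigma>, the witness rule lets \<chi> imply it as
  well, so \<theta> and \<chi> were already inconsistent.\<close>

lemma add_witness_consistent:
  fixes \<theta> \<chi> :: "('p, 'n) form"
  assumes inf: "infinite (UNIV :: 'n set)" and cons: "\<not> \<turnstile> \<^bold>\<not> (\<theta> \<^bold>\<and> \<chi>)"
  shows "\<not> \<turnstile> \<^bold>\<not> add_witness \<theta> \<chi>"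
proof (cases "\<exists>g. witness \<chi> g")
  case True
  then obtain g where g: "witness \<chi> g" by blast
  define k where "k = (SOME k. k \<notin> noms (\<theta> \<^bold>\<and> \<chi>))"
  \<comment> \<open>This makes the \<open>SOME\<close> in \<open>add_witness\<close> pick a
    genuinely fresh nominal.\<close>
  have "\<exists>k. k \<notin> noms (\<theta> \<^bold>\<and> \<chi>)"
    using inf finite_noms ex_new_if_finite by blast
  then have k: "k \<notin> noms (\<theta> \<^bold>\<and> \<chi>)"
    unfolding k_def by (rule someI_ex)
  show ?thesis
  proof
    assume "\<turnstile> \<^bold>\<not> add_witness \<theta> \<chi>"
    then have "\<turnstile> \<^bold>\<not> (g k \<^bold>\<and> (\<theta> \<^bold>\<and> \<chi>))"
      by (simp only: add_witness_eq[OF g] k_def)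
    then have "\<turnstile> g k \<^bold>\<rightarrow> \<^bold>\<not> (\<theta> \<^bold>\<and> \<chi>)"
      by (rule derivable_taut_mp[rotated]) (auto simp: tautology_def)
    then have "\<turnstile> \<chi> \<^bold>\<rightarrow> \<^bold>\<not> (\<theta> \<^bold>\<and> \<chi>)"
      by (rule witness_rule[OF g, rotated]) (use k in auto)
    then have "\<turnstile> \<^bold>\<not> (\<theta> \<^bold>\<and> \<chi>)"
      by (rule derivable_taut_mp[rotated]) (auto simp: tautology_def)
    with cons show False ..
  qed
next
  case False
  then show ?thesis using cons by (simp add: add_witness_def)
qed

lemma stage_consistent:
  fixes \<theta> :: "('p :: countable, 'n :: countable) form"
  assumes "infinite (UNIV :: 'n set)" "\<not> \<turnstile> \<^bold>\<not> \<theta>"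
  shows "\<not> \<turnstile> \<^bold>\<not> stage \<theta> i"
proof (induction i)
  case 0
  show ?case using assms(2) by simp
next
  case (Suc i)
  then show ?case by (simp add: add_witness_consistent[OF assms(1)])
qed

lemma Imp_refl: "\<turnstile> \<phi> \<^bold>\<rightarrow> \<phi>"
  by (rule Taut) (auto simp: tautology_def)

lemma stage_Suc: "\<turnstile> stage \<theta> (Suc i) \<^bold>\<rightarrow> stage \<theta> i"
proof (cases "\<turnstile> \<^bold>\<not> (stage \<theta> i \<^bold>\<and> from_nat i)")
  case True
  then show ?thesis by (simp add: Imp_refl)
next
  case False
  have "\<turnstile> add_witness (stage \<theta> i) (from_nat i) \<^bold>\<rightarrow> stage \<theta> i"
    by (rule Imp_trans[OF add_witness_Imp]) (rule Taut, auto simp: tautology_def)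
  with False show ?thesis by simp
qed

lemma stage_mono: "i \<le> j \<Longrightarrow> \<turnstile> stage \<theta> j \<^bold>\<rightarrow> stage \<theta> i"
  by (induction rule: dec_induct) (rule Imp_refl, rule Imp_trans[OF stage_Suc])

theorem witnessed_extension:
  fixes \<theta> :: "('p :: countable, 'n :: countable) form"
  assumes inf: "infinite (UNIV :: 'n set)" and cons: "\<not> \<turnstile> \<^bold>\<not> \<theta>"
  obtains \<Gamma> where "mcs \<Gamma>" "\<theta> \<in> \<Gamma>"
    "\<And>\<chi> g. \<chi> \<in> \<Gamma> \<Longrightarrow> witness \<chi> g \<Longrightarrow> \<exists>k. g k \<in> \<Gamma>"
proof
  \<comment> \<open>All consequences of the stages. Later stages imply earlier ones, so any two
    members follow from a common stage.\<close>
  define \<Gamma> where "\<Gamma> = {\<chi>. \<exists>i. \<turnstile> stage \<theta> i \<^bold>\<rightarrow> \<chi>}"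
  note cons_stage = stage_consistent[OF inf cons]
  have later: "\<turnstile> stage \<theta> j \<^bold>\<rightarrow> \<chi>" if "\<turnstile> stage \<theta> i \<^bold>\<rightarrow> \<chi>" "i \<le> j" for i j \<chi>
    by (rule Imp_trans[OF stage_mono[OF that(2)] that(1)])
  have common: "\<exists>i. (\<turnstile> stage \<theta> i \<^bold>\<rightarrow> \<chi>) \<and> (\<turnstile> stage \<theta> i \<^bold>\<rightarrow> \<xi>)" if in_\<Gamma>: "\<chi> \<in> \<Gamma>" "\<xi> \<in> \<Gamma>" for \<chi> \<xi>
  proof -
    obtain i j where "\<turnstile> stage \<theta> i \<^bold>\<rightarrow> \<chi>" "\<turnstile> stage \<theta> j \<^bold>\<rightarrow> \<xi>"
      using in_\<Gamma> unfolding \<Gamma>_def by blast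
    then have "\<turnstile> stage \<theta> (max i j) \<^bold>\<rightarrow> \<chi>" "\<turnstile> stage \<theta> (max i j) \<^bold>\<rightarrow> \<xi>"
      by (auto intro: later)
    then show ?thesis by blast
  qed
  \<comment> \<open>As \<open>from_nat\<close> inverts \<open>to_nat\<close>, the formula \<chi> is
    treated exactly in the step after stage \<open>to_nat \<chi>\<close>.\<close>
  have in_stage: "\<turnstile> stage \<theta> (Suc (to_nat \<chi>)) \<^bold>\<rightarrow> add_witness (stage \<theta> (to_nat \<chi>)) \<chi>"
    if "\<not> \<turnstile> \<^bold>\<not> (stage \<theta> (to_nat \<chi>) \<^bold>\<and> \<chi>)" for \<chi>
    using that by (simp add: Imp_refl)
  have not_both: "\<^bold>\<not> \<chi> \<notin> \<Gamma>" if "\<chi> \<in> \<Gamma>" for \<chi>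
  proof
    assume "\<^bold>\<not> \<chi> \<in> \<Gamma>"
    with that obtain i where "\<turnstile> stage \<theta> i \<^bold>\<rightarrow> \<chi>" "\<turnstile> stage \<theta> i \<^bold>\<rightarrow> \<^bold>\<not> \<chi>"
      using common by blast
    then have "\<turnstile> \<^bold>\<not> stage \<theta> i"
      by (rule derivable_taut_mp2[rotated]) (auto simp: tautology_def)
    with cons_stage show False by blast
  qed
  \<comment> \<open>Each formula is decided at its own step: either the stage already implies its
    negation, or the next stage implies it.\<close>
  have in_or_inconsistent: "\<chi> \<in> \<Gamma> \<or> \<^bold>\<not> \<chi> \<in> \<Gamma>" for \<chi>
  proof (cases "\<turnstile> \<^bold>\<not> (stage \<theta> (to_nat \<chi>) \<^bold>\<and> \<chi>)")
    case True
    then have "\<turnstile> stage \<theta> (to_nat \<chi>) \<^bold>\<rightarrow> \<^bold>\<not> \<chi>"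
      by (rule derivable_taut_mp[rotated]) (auto simp: tautology_def)
    then show ?thesis unfolding \<Gamma>_def by blast
  next
    case False
    have "\<turnstile> add_witness (stage \<theta> (to_nat \<chi>)) \<chi> \<^bold>\<rightarrow> \<chi>"
      by (rule Imp_trans[OF add_witness_Imp]) (rule Taut, auto simp: tautology_def)
    from Imp_trans[OF in_stage[OF False] this] show ?thesis
      unfolding \<Gamma>_def by blast
  qed
  show "mcs \<Gamma>"
  proof
    show "\<chi> \<in> \<Gamma>" if "\<turnstile> \<chi>" for \<chi>
    proof -
      have "\<turnstile> stage \<theta> 0 \<^bold>\<rightarrow> \<chi>"
        by (rule derivable_taut_mp[OF _ that]) (simp add: tautology_def)
      then show ?thesis unfolding \<Gamma>_def by blast
    qed
    show "\<xi> \<in> \<Gamma>" if in_\<Gamma>: "(\<chi> \<^bold>\<rightarrow> \<xi>) \<in> \<Gamma>" "\<chi> \<in> \<Gamma>" for \<chi> \<xi>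
    proof -
      obtain i where "\<turnstile> stage \<theta> i \<^bold>\<rightarrow> (\<chi> \<^bold>\<rightarrow> \<xi>)" "\<turnstile> stage \<theta> i \<^bold>\<rightarrow> \<chi>"
        using common[OF in_\<Gamma>] by blast
      then have "\<turnstile> stage \<theta> i \<^bold>\<rightarrow> \<xi>"
        by (rule derivable_taut_mp2[rotated]) (auto simp: tautology_def)
      then show ?thesis unfolding \<Gamma>_def by blast
    qed
    show "\<^bold>\<not> \<chi> \<in> \<Gamma> \<longleftrightarrow> \<chi> \<notin> \<Gamma>" for \<chi>
      using not_both in_or_inconsistent by blast
  qed
  have "\<turnstile> stage \<theta> 0 \<^bold>\<rightarrow> \<theta>"
    by (simp add: Imp_refl)
  then show "\<theta> \<in> \<Gamma>"
    unfolding \<Gamma>_def by blast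
  show "\<exists>k. g k \<in> \<Gamma>" if "\<chi> \<in> \<Gamma>" "witness \<chi> g" for \<chi> g
  proof -
    \<comment> \<open>A member of \<Gamma> cannot have been rejected at its step, since its negation
      would then be in \<Gamma> too. Hence it was accepted together with its witness.\<close>
    have "\<not> \<turnstile> \<^bold>\<not> (stage \<theta> (to_nat \<chi>) \<^bold>\<and> \<chi>)"
    proof
      assume "\<turnstile> \<^bold>\<not> (stage \<theta> (to_nat \<chi>) \<^bold>\<and> \<chi>)"
      then have "\<turnstile> stage \<theta> (to_nat \<chi>) \<^bold>\<rightarrow> \<^bold>\<not> \<chi>"
        by (rule derivable_taut_mp[rotated]) (auto simp: tautology_def)
      then show False
        using not_both[OF that(1)] unfolding \<Gamma>_def by blast
    qed
    from in_stage[OF this]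
    have "\<turnstile> stage \<theta> (Suc (to_nat \<chi>)) \<^bold>\<rightarrow> g (SOME k. k \<notin> noms (stage \<theta> (to_nat \<chi>) \<^bold>\<and> \<chi>))"
      unfolding add_witness_eq[OF that(2)]
      by (rule Imp_trans) (rule Taut, auto simp: tautology_def)
    then show ?thesis unfolding \<Gamma>_def by blast
  qed
qed


section \<open>The canonical model\<close>

lemma submodel_submodel: "submodel (submodel M D) D' = submodel M (D \<inter> D')"
  by (auto simp: submodel_def)

lemma rel_submodel: "rel (submodel M D) = rel M \<inter> D \<times> D"
  by (simp add: submodel_def)

lemma submodel_whole: "is_model M \<Longrightarrow> worlds M \<subseteq> D \<Longrightarrow> submodel M D = M"
  by (rule model.equality) (auto simp: is_model_def submodel_def Int_absorb2 fun_eq_iff subset_iff)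

definition theory_at :: "('p, 'n) form set \<Rightarrow> 'n \<Rightarrow> ('p, 'n) form set" where
  "theory_at \<Gamma> n = {\<chi>. \<^bold>E (Nom n \<^bold>\<and> \<chi>) \<in> \<Gamma>}"

text \<open>The map \<open>w\<close> realises nominals as elements of the type over which validity
  is stated. Nominals with equal theories are sent to one point, so equality of theories stands for
  provable identity.\<close>

locale witnessed = mcs \<Gamma>
  for \<Gamma> :: "('p, 'n) form set" +
  fixes w :: "'n \<Rightarrow> 'w"
  assumes witness: "\<chi> \<in> \<Gamma> \<Longrightarrow> witness \<chi> g \<Longrightarrow> \<exists>k. g k \<in> \<Gamma>"
    and w_eq_iff: "w n = w m \<longleftrightarrow> theory_at \<Gamma> n = theory_at \<Gamma> m"
begin

section \<open>Theories of the named worlds\<close>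

abbreviation \<Delta> :: "'n \<Rightarrow> ('p, 'n) form set" where
  "\<Delta> \<equiv> theory_at \<Gamma>"

definition denotes :: "'n \<Rightarrow> bool" where
  "denotes n \<longleftrightarrow> \<^bold>E Nom n \<in> \<Gamma>"

lemma at_U: "\<chi> \<in> \<Delta> n \<Longrightarrow> \<^bold>U (Nom n \<^bold>\<rightarrow> \<chi>) \<in> \<Gamma>"
  unfolding theory_at_def using derivable_Imp[OF H] by blast

lemma denotes_if_at: "\<chi> \<in> \<Delta> n \<Longrightarrow> denotes n"
  unfolding theory_at_def denotes_def mem_Collect_eq
  by (rule derivable_Imp[OF Ex_mono]) (rule Taut, auto simp: tautology_def)

lemma denotes_right: "Nom m \<in> \<Delta> n \<Longrightarrow> denotes m"
  unfolding theory_at_def denotes_def mem_Collect_eq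
  by (rule derivable_Imp[OF Ex_mono]) (rule Taut, auto simp: tautology_def)

text \<open>Closure under modus ponens and consistency rest on (H), through \<open>at_U\<close>;
  containing all theorems and deciding every formula rest on \<open>n\<close> denoting.\<close>

lemma mcs_at:
  assumes "denotes n"
  shows "mcs (\<Delta> n)"
proof
  show "\<chi> \<in> \<Delta> n" if "\<turnstile> \<chi>" for \<chi>
  proof -
    have "\<turnstile> Nom n \<^bold>\<rightarrow> Nom n \<^bold>\<and> \<chi>"
      by (rule derivable_taut_mp[OF _ that]) (simp add: tautology_def)
    from derivable_Imp[OF Ex_mono[OF this]] show ?thesis
      using assms unfolding denotes_def theory_at_def by blast
  qed
  show "\<xi> \<in> \<Delta> n" if "(\<chi> \<^bold>\<rightarrow> \<xi>) \<in> \<Delta> n" "\<chi> \<in> \<Delta> n" for \<chi> \<xi>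
    unfolding theory_at_def mem_Collect_eq
    by (rule U_Ex[OF at_U[OF that(2)] that(1)[unfolded theory_at_def mem_Collect_eq]])
      (rule Taut, auto simp: tautology_def)
  show "\<^bold>\<not> \<chi> \<in> \<Delta> n \<longleftrightarrow> \<chi> \<notin> \<Delta> n" for \<chi>
  proof
    assume "\<^bold>\<not> \<chi> \<in> \<Delta> n"
    show "\<chi> \<notin> \<Delta> n"
    proof
      assume "\<chi> \<in> \<Delta> n"
      have "\<^bold>E \<^bold>\<not> (Nom n \<^bold>\<rightarrow> \<chi>) \<in> \<Gamma>"
        by (rule derivable_Imp[OF Ex_mono
              \<open>\<^bold>\<not> \<chi> \<in> \<Delta> n\<close>[unfolded theory_at_def mem_Collect_eq]])
          (rule Taut, auto simp: tautology_def)
      with at_U[OF \<open>\<chi> \<in> \<Delta> n\<close>] show False by (simp add: Neg_iff)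
    qed
  next
    assume "\<chi> \<notin> \<Delta> n"
    then have "\<^bold>U \<^bold>\<not> (Nom n \<^bold>\<and> \<chi>) \<in> \<Gamma>"
      using derivable_Iff[OF Ex_Neg_Neg_Iff] by (simp add: Neg_iff theory_at_def)
    then show "\<^bold>\<not> \<chi> \<in> \<Delta> n"
      using assms unfolding theory_at_def mem_Collect_eq denotes_def
      by (rule U_Ex) (rule Taut, auto simp: tautology_def)
  qed
qed

lemma at_Neg [simp]: "denotes n \<Longrightarrow> \<^bold>\<not> \<chi> \<in> \<Delta> n \<longleftrightarrow> \<chi> \<notin> \<Delta> n"
  by (rule mcs.Neg_iff[OF mcs_at])

lemma at_Or [simp]: "denotes n \<Longrightarrow> (\<chi> \<^bold>\<or> \<xi>) \<in> \<Delta> n \<longleftrightarrow> \<chi> \<in> \<Delta> n \<or> \<xi> \<in> \<Delta> n"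
  by (rule mcs.Or_iff[OF mcs_at])

lemma at_Top [simp]: "denotes n \<Longrightarrow> \<^bold>\<top> \<in> \<Delta> n"
  by (rule mcs.derivable[OF mcs_at]) (auto intro!: Taut simp: tautology_def)

lemma at_self: "denotes n \<Longrightarrow> Nom n \<in> \<Delta> n"
  unfolding theory_at_def denotes_def mem_Collect_eq
  by (rule derivable_Imp[OF Ex_mono]) (rule Taut, auto simp: tautology_def)

lemma at_Iff: "denotes n \<Longrightarrow> \<turnstile> \<chi> \<^bold>\<leftrightarrow> \<xi> \<Longrightarrow> \<chi> \<in> \<Delta> n \<longleftrightarrow> \<xi> \<in> \<Delta> n"
  by (rule mcs.derivable_Iff[OF mcs_at])

text \<open>If \<open>m\<close> holds at \<open>n\<close>, then \<open>at_U\<close> carries every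
  formula true at \<open>m\<close> over to \<open>n\<close>, and an inclusion between maximal
  consistent sets is an equality.\<close>

lemma at_Nom:
  assumes "denotes n"
  shows "Nom m \<in> \<Delta> n \<longleftrightarrow> denotes m \<and> \<Delta> n = \<Delta> m"
proof
  assume m: "Nom m \<in> \<Delta> n"
  have "\<chi> \<in> \<Delta> n" if "\<chi> \<in> \<Delta> m" for \<chi>
    unfolding theory_at_def mem_Collect_eq
    by (rule U_Ex[OF at_U[OF that] m[unfolded theory_at_def mem_Collect_eq]])
      (rule Taut, auto simp: tautology_def)
  with assms denotes_right[OF m] show "denotes m \<and> \<Delta> n = \<Delta> m"
    by (metis at_Neg subsetI subset_antisym)
qed (use at_self in blast)

lemma at_U_iff:
  assumes "denotes n"
  shows "\<^bold>U \<chi> \<in> \<Delta> n \<longleftrightarrow> \<^bold>U \<chi> \<in> \<Gamma>"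
proof
  assume "\<^bold>U \<chi> \<in> \<Delta> n"
  have "\<^bold>E \<^bold>U \<chi> \<in> \<Gamma>"
    by (rule derivable_Imp[OF Ex_mono \<open>\<^bold>U \<chi> \<in> \<Delta> n\<close>[unfolded theory_at_def mem_Collect_eq]])
      (rule Taut, auto simp: tautology_def)
  show "\<^bold>U \<chi> \<in> \<Gamma>"
  proof (rule ccontr)
    assume "\<^bold>U \<chi> \<notin> \<Gamma>"
    then have "\<^bold>E \<^bold>\<not> \<chi> \<in> \<Gamma>"
      by (simp add: Neg_iff)
    \<comment> \<open>With the abbreviations unfolded, this is literally the negation of the formula
      shown above to be in \<Gamma>.\<close>
    then have "\<^bold>U \<^bold>E \<^bold>\<not> \<chi> \<in> \<Gamma>"
      by (rule derivable_Imp[OF U_5])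
    with \<open>\<^bold>E \<^bold>U \<chi> \<in> \<Gamma>\<close> show False by (simp add: Neg_iff)
  qed
next
  assume "\<^bold>U \<chi> \<in> \<Gamma>"
  then have "\<^bold>U \<^bold>U \<chi> \<in> \<Gamma>"
    by (rule derivable_Imp[OF U_4])
  then show "\<^bold>U \<chi> \<in> \<Delta> n"
    using assms unfolding theory_at_def mem_Collect_eq denotes_def
    by (rule U_Ex) (rule Taut, auto simp: tautology_def)
qed

lemma at_Ex [simp]:
  assumes "denotes n"
  shows "\<^bold>E \<chi> \<in> \<Delta> n \<longleftrightarrow> (\<exists>m. denotes m \<and> \<chi> \<in> \<Delta> m)"
proof
  assume "\<^bold>E \<chi> \<in> \<Delta> n"
  then have "\<exists>m. (\<^bold>E (Nom n \<^bold>\<and> \<^bold>E Nom m) \<^bold>\<and> \<^bold>E (Nom m \<^bold>\<and> \<chi>)) \<in> \<Gamma>"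
    by (intro witness[OF _ witness.Ex]) (simp add: theory_at_def)
  then obtain m where m: "\<chi> \<in> \<Delta> m"
    by (auto simp: Neg_iff Or_iff theory_at_def)
  with denotes_if_at show "\<exists>m. denotes m \<and> \<chi> \<in> \<Delta> m" by blast
next
  assume "\<exists>m. denotes m \<and> \<chi> \<in> \<Delta> m"
  then obtain m where m: "\<chi> \<in> \<Delta> m" by blast
  have "\<^bold>E \<chi> \<in> \<Gamma>"
    by (rule derivable_Imp[OF Ex_mono m[unfolded theory_at_def mem_Collect_eq]])
      (rule Taut, auto simp: tautology_def)
  then have "\<^bold>U \<^bold>E \<chi> \<in> \<Gamma>"
    by (rule derivable_Imp[OF U_5])
  then show "\<^bold>E \<chi> \<in> \<Delta> n"
    using assms unfolding theory_at_def mem_Collect_eq denotes_def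
    by (rule U_Ex) (rule Taut, auto simp: tautology_def)
qed

text \<open>Left to right, Paste supplies a named successor. Right to left, the universal statement
  that \<open>m\<close> implies \<chi> yields its \<open>Box\<close> version at \<open>n\<close>,
  and K then transfers the diamond from \<open>Nom m\<close> to \<chi>.\<close>

lemma at_Dia:
  assumes n: "denotes n"
  shows "\<^bold>\<diamond> \<chi> \<in> \<Delta> n \<longleftrightarrow> (\<exists>m. denotes m \<and> \<^bold>\<diamond> Nom m \<in> \<Delta> n \<and> \<chi> \<in> \<Delta> m)"
proof
  assume "\<^bold>\<diamond> \<chi> \<in> \<Delta> n"
  then have "\<exists>m. (\<^bold>E (Nom n \<^bold>\<and> \<^bold>\<diamond> Nom m) \<^bold>\<and> \<^bold>E (Nom m \<^bold>\<and> \<chi>)) \<in> \<Gamma>"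
    by (intro witness[OF _ witness.Dia]) (simp add: theory_at_def)
  then obtain m where m: "\<chi> \<in> \<Delta> m" "\<^bold>\<diamond> Nom m \<in> \<Delta> n"
    by (auto simp: Neg_iff Or_iff theory_at_def)
  with denotes_if_at show "\<exists>m. denotes m \<and> \<^bold>\<diamond> Nom m \<in> \<Delta> n \<and> \<chi> \<in> \<Delta> m" by blast
next
  assume "\<exists>m. denotes m \<and> \<^bold>\<diamond> Nom m \<in> \<Delta> n \<and> \<chi> \<in> \<Delta> m"
  then obtain m where m: "\<^bold>\<diamond> Nom m \<in> \<Delta> n" "\<chi> \<in> \<Delta> m" by blast
  interpret at: mcs "\<Delta> n" by (rule mcs_at[OF n])
  have "\<turnstile> (Nom m \<^bold>\<rightarrow> \<chi>) \<^bold>\<rightarrow> (\<^bold>\<not> \<chi> \<^bold>\<rightarrow> \<^bold>\<not> Nom m)"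
    by (rule Taut) (auto simp: tautology_def)
  then have "\<turnstile> \<^bold>\<box> (Nom m \<^bold>\<rightarrow> \<chi>) \<^bold>\<rightarrow> (\<^bold>\<box> \<^bold>\<not> \<chi> \<^bold>\<rightarrow> \<^bold>\<box> \<^bold>\<not> Nom m)"
    by (rule Imp_trans[OF MP[OF K_Box Nec_Box] K_Box])
  moreover have "\<^bold>\<box> (Nom m \<^bold>\<rightarrow> \<chi>) \<in> \<Delta> n"
    using at_U[OF m(2)] at_U_iff[OF n] at.derivable_Imp[OF U_Box] by blast
  ultimately have "(\<^bold>\<box> \<^bold>\<not> \<chi> \<^bold>\<rightarrow> \<^bold>\<box> \<^bold>\<not> Nom m) \<in> \<Delta> n"
    by (rule at.derivable_Imp)
  moreover have "\<turnstile> \<^bold>\<diamond> \<^bold>\<not> \<^bold>\<not> \<xi> \<^bold>\<leftrightarrow> \<^bold>\<diamond> \<xi>" for \<xi> :: "('p, 'n) form"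
    by (rule Replacement[OF Neg_Neg_Iff replaces.Dia[OF replaces.here]])
  ultimately show "\<^bold>\<diamond> \<chi> \<in> \<Delta> n"
    using m(1) n at_Iff[OF n] by simp blast
qed

section \<open>Announcement and removal at a named world\<close>

lemma at_Ann_Neg [simp]:
  "denotes n \<Longrightarrow> \<langle>!\<phi>\<rangle> \<^bold>\<not> \<psi> \<in> \<Delta> n \<longleftrightarrow> \<phi> \<in> \<Delta> n \<and> \<langle>!\<phi>\<rangle> \<psi> \<notin> \<Delta> n"
  using at_Iff[OF _ Ann_Neg] by simp

lemma at_Ann_Or [simp]:
  "denotes n \<Longrightarrow> \<langle>!\<phi>\<rangle> (\<psi> \<^bold>\<or> \<alpha>) \<in> \<Delta> n \<longleftrightarrow> \<langle>!\<phi>\<rangle> \<psi> \<in> \<Delta> n \<or> \<langle>!\<phi>\<rangle> \<alpha> \<in> \<Delta> n"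
  using at_Iff[OF _ Ann_Or] by simp

lemma at_Ann_Nom [simp]:
  "denotes n \<Longrightarrow> \<langle>!\<phi>\<rangle> Nom m \<in> \<Delta> n \<longleftrightarrow> \<phi> \<in> \<Delta> n \<and> Nom m \<in> \<Delta> n"
  using at_Iff[OF _ Ann_Nom] by simp

lemma at_Ann_Ex [simp]:
  "denotes n \<Longrightarrow> \<langle>!\<phi>\<rangle> \<^bold>E \<psi> \<in> \<Delta> n \<longleftrightarrow> \<phi> \<in> \<Delta> n \<and> (\<exists>m. denotes m \<and> \<langle>!\<phi>\<rangle> \<psi> \<in> \<Delta> m)"
  using at_Iff[OF _ Ann_Ex] by simp

lemma at_Ann_Ann:
  "denotes n \<Longrightarrow> \<langle>!\<phi>\<rangle> \<langle>!\<psi>\<rangle> \<alpha> \<in> \<Delta> n \<longleftrightarrow> \<langle>!\<phi> \<^bold>\<and> \<^bold>[!\<phi>\<^bold>] \<psi>\<rangle> \<alpha> \<in> \<Delta> n"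
  by (rule at_Iff[OF _ Ann_Ann])

text \<open>This stands in for a reduction axiom for \<open>Rem\<close>: the Mix rule provides a
  name for the removed world, and the Mix axiom, applied under the announcement, gives the
  converse.\<close>

lemma at_Ann_Rem:
  assumes n: "denotes n"
  shows "\<langle>!\<phi>\<rangle> \<langle>-\<alpha>\<rangle> \<psi> \<in> \<Delta> n \<longleftrightarrow>
    (\<exists>k. \<langle>!\<phi>\<rangle> (\<^bold>E (Nom k \<^bold>\<and> \<alpha>) \<^bold>\<and> \<langle>!\<^bold>\<not> Nom k\<rangle> \<psi>) \<in> \<Delta> n)"
proof
  assume "\<langle>!\<phi>\<rangle> \<langle>-\<alpha>\<rangle> \<psi> \<in> \<Delta> n"
  then have "\<exists>k. \<^bold>E (Nom n \<^bold>\<and> \<langle>!\<phi>\<rangle> (\<^bold>E (Nom k \<^bold>\<and> \<alpha>) \<^bold>\<and> \<langle>!\<^bold>\<not> Nom k\<rangle> \<psi>)) \<in> \<Gamma>"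
    by (intro witness[OF _ witness.Rem]) (simp add: theory_at_def)
  then show "\<exists>k. \<langle>!\<phi>\<rangle> (\<^bold>E (Nom k \<^bold>\<and> \<alpha>) \<^bold>\<and> \<langle>!\<^bold>\<not> Nom k\<rangle> \<psi>) \<in> \<Delta> n"
    by (simp add: theory_at_def)
next
  assume "\<exists>k. \<langle>!\<phi>\<rangle> (\<^bold>E (Nom k \<^bold>\<and> \<alpha>) \<^bold>\<and> \<langle>!\<^bold>\<not> Nom k\<rangle> \<psi>) \<in> \<Delta> n"
  then show "\<langle>!\<phi>\<rangle> \<langle>-\<alpha>\<rangle> \<psi> \<in> \<Delta> n"
    by (elim exE) (rule mcs.derivable_Imp[OF mcs_at[OF n] Ann_mono[OF Mix_Axiom]])
qed

section \<open>The model on named worlds\<close>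

definition canonical :: "('w, 'p, 'n) model" where
  "canonical =
     \<lparr> worlds = {w n |n. denotes n},
       rel = {(w n, w m) |n m. denotes n \<and> denotes m \<and> \<^bold>\<diamond> Nom m \<in> \<Delta> n},
       valP = (\<lambda>p. {w n |n. denotes n \<and> Prop p \<in> \<Delta> n}),
       valN = (\<lambda>m. {w n |n. denotes n \<and> Nom m \<in> \<Delta> n}) \<rparr>"

definition extension :: "('p, 'n) form \<Rightarrow> 'w set" where
  "extension \<phi> = {w n |n. denotes n \<and> \<phi> \<in> \<Delta> n}"

lemma is_model_canonical: "is_model canonical"
  unfolding is_model_def canonical_def by (auto simp: at_Nom w_eq_iff)

text \<open>The sets of the model are given through some name of each world; this removes the
  dependence on the name. A nominal sharing the theory of a denoting one has a nonempty theory,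
  hence denotes.\<close>

lemma w_in_extension: "w n \<in> extension \<phi> \<longleftrightarrow> denotes n \<and> \<phi> \<in> \<Delta> n"
proof -
  have "denotes n" if "denotes m" "\<Delta> n = \<Delta> m" for m
    using at_self[OF that(1)] that(2) denotes_if_at by blast
  then show ?thesis
    unfolding extension_def by (auto simp: w_eq_iff)
qed

lemma w_in_worlds: "w n \<in> worlds canonical \<longleftrightarrow> denotes n"
  using w_in_extension[of n "\<^bold>\<top>"] by (auto simp: canonical_def extension_def)

lemma w_in_valP: "w n \<in> valP canonical p \<longleftrightarrow> denotes n \<and> Prop p \<in> \<Delta> n"
  using w_in_extension[of n "Prop p"] by (simp add: canonical_def extension_def)

lemma w_in_valN: "w n \<in> valN canonical m \<longleftrightarrow> denotes n \<and> Nom m \<in> \<Delta> n"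
  using w_in_extension[of n "Nom m"] by (simp add: canonical_def extension_def)

text \<open>Equal theories allow the source to be renamed at once. For the target, the old name
  witnesses \<open>at_Dia\<close> for the new one, which holds there by equality of
  theories.\<close>

lemma w_in_rel:
  "(w n, w m) \<in> rel canonical \<longleftrightarrow> denotes n \<and> denotes m \<and> \<^bold>\<diamond> Nom m \<in> \<Delta> n"
proof
  assume "(w n, w m) \<in> rel canonical"
  then obtain n' m' where *: "denotes n'" "denotes m'" "\<^bold>\<diamond> Nom m' \<in> \<Delta> n'" "\<Delta> n = \<Delta> n'" "\<Delta> m = \<Delta> m'"
    by (auto simp: canonical_def w_eq_iff)
  then have "denotes n" "denotes m"
    using at_self denotes_if_at by blast+
  with * have "Nom m \<in> \<Delta> m'"
    using at_self by blast
  with * show "denotes n \<and> denotes m \<and> \<^bold>\<diamond> Nom m \<in> \<Delta> n"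
    using at_Dia[OF \<open>denotes n\<close>, of "Nom m"] \<open>denotes n\<close> \<open>denotes m\<close> by auto
qed (auto simp: canonical_def)

lemma extensionE:
  assumes "x \<in> extension \<phi>"
  obtains n where "x = w n" "denotes n" "\<phi> \<in> \<Delta> n"
  using assms by (auto simp: extension_def)

lemma ex_extension: "(\<exists>t \<in> extension \<phi>. P t) \<longleftrightarrow> (\<exists>m. denotes m \<and> \<phi> \<in> \<Delta> m \<and> P (w m))"
  by (auto simp: extension_def)

lemma extension_subset_worlds: "extension \<phi> \<subseteq> worlds canonical"
  by (auto simp: extension_def canonical_def)

lemma worlds_submodel_extension: "worlds (submodel canonical (extension \<phi>)) = extension \<phi>"
  using extension_subset_worlds by (auto simp: submodel_def)

section \<open>Truth lemma relative to an announcement\<close>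

lemma truth:
  "denotes n \<Longrightarrow>
    \<langle>!\<phi>\<rangle> \<psi> \<in> \<Delta> n \<longleftrightarrow> \<phi> \<in> \<Delta> n \<and> (submodel canonical (extension \<phi>), w n \<Turnstile> \<psi>)"
proof (induction \<psi> arbitrary: \<phi> n)
  case (Prop p)
  then show ?case
    using at_Iff[OF _ Ann_Prop] by (auto simp: submodel_def w_in_valP w_in_extension)
next
  case (Nom m)
  then show ?case
    by (auto simp: submodel_def w_in_valN w_in_extension)
next
  case Top
  then show ?case
    using at_Iff[OF _ Ann_Top] by simp
next
  case (Neg \<psi>)
  then show ?case by auto
next
  case (Or \<psi> \<alpha>)
  then show ?case by auto
next
  case (Dia \<psi>)
  have "\<langle>!\<phi>\<rangle> \<^bold>\<diamond> \<psi> \<in> \<Delta> n \<longleftrightarrow>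
      \<phi> \<in> \<Delta> n \<and> (\<exists>m. denotes m \<and> \<^bold>\<diamond> Nom m \<in> \<Delta> n \<and> \<langle>!\<phi>\<rangle> \<psi> \<in> \<Delta> m)"
    using Dia.prems at_Iff[OF _ Ann_Dia] at_Dia[of n "\<langle>!\<phi>\<rangle> \<psi>"] by simp
  \<comment> \<open>The restricted relation needs both endpoints in the extension: \<phi> holds at
    \<open>n\<close> by the first conjunct, and at \<open>m\<close> by the induction hypothesis for
    \<psi>.\<close>
  also have "\<dots> \<longleftrightarrow> \<phi> \<in> \<Delta> n \<and> (\<exists>t \<in> extension \<phi>. w n \<in> extension \<phi> \<and>
      (w n, t) \<in> rel canonical \<and> (submodel canonical (extension \<phi>), t \<Turnstile> \<psi>))"
    unfolding ex_extension using Dia by (auto simp: w_in_rel w_in_extension)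
  also have "\<dots> \<longleftrightarrow> \<phi> \<in> \<Delta> n \<and> (submodel canonical (extension \<phi>), w n \<Turnstile> \<^bold>\<diamond> \<psi>)"
    by (auto simp: rel_submodel)
  finally show ?case .
next
  case (Ann \<chi> \<alpha>)
  let ?M = "submodel canonical (extension \<phi>)"
  let ?\<phi>' = "\<phi> \<^bold>\<and> \<^bold>[!\<phi>\<^bold>] \<chi>"
  \<comment> \<open>The formula \<open>?\<phi>'\<close> comes from the composition axiom. Its
    extension is the domain left after both announcements, and the second induction hypothesis is
    used with it in place of \<phi>.\<close>
  have \<phi>': "?\<phi>' \<in> \<Delta> m \<longleftrightarrow> \<phi> \<in> \<Delta> m \<and> (?M, w m \<Turnstile> \<chi>)" if "denotes m" for m
    using that Ann.IH(1)[OF that] by auto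
  have "extension ?\<phi>' = extension \<phi> \<inter> {t \<in> worlds ?M. ?M, t \<Turnstile> \<chi>}"
    unfolding worlds_submodel_extension
    by (auto elim!: extensionE simp: w_in_extension \<phi>' simp del: at_Neg at_Or)
  then have "submodel canonical (extension ?\<phi>') = submodel ?M {t \<in> worlds ?M. ?M, t \<Turnstile> \<chi>}"
    by (simp only: submodel_submodel)
  then show ?case
    using Ann.prems \<phi>' Ann.IH(2)[of n ?\<phi>'] by (auto simp: at_Ann_Ann)
next
  case (Rem \<alpha> \<psi>)
  let ?M = "submodel canonical (extension \<phi>)"
  \<comment> \<open>Announcing the negation of \<open>Nom k\<close> after \<phi> deletes exactly
    \<open>w k\<close>, because by \<open>at_Nom\<close> only the worlds with the theory of
    \<open>k\<close> satisfy \<open>Nom k\<close>.\<close>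
  have remove: "submodel canonical (extension (\<phi> \<^bold>\<and> \<^bold>[!\<phi>\<^bold>] \<^bold>\<not> Nom k)) = remove ?M {w k}"
    if "denotes k" for k
  proof -
    have "extension (\<phi> \<^bold>\<and> \<^bold>[!\<phi>\<^bold>] \<^bold>\<not> Nom k) = extension \<phi> - {w k}"
      using that by (auto elim!: extensionE simp: w_in_extension at_Nom w_eq_iff)
    also have "\<dots> = extension \<phi> \<inter> (extension \<phi> - {w k})"
      by blast
    finally show ?thesis
      by (simp only: remove_def submodel_submodel worlds_submodel_extension)
  qed
  have "\<langle>!\<phi>\<rangle> \<langle>-\<alpha>\<rangle> \<psi> \<in> \<Delta> n \<longleftrightarrow> (\<exists>k. \<phi> \<in> \<Delta> n \<and>
      (\<exists>m. denotes m \<and> \<phi> \<in> \<Delta> m \<and> Nom k \<in> \<Delta> m \<and> \<langle>!\<phi>\<rangle> \<alpha> \<in> \<Delta> m) \<and>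
      \<langle>!\<phi> \<^bold>\<and> \<^bold>[!\<phi>\<^bold>] \<^bold>\<not> Nom k\<rangle> \<psi> \<in> \<Delta> n)"
    using Rem.prems by (auto simp: at_Ann_Rem at_Ann_Ann)
  \<comment> \<open>A world \<open>m\<close> at which \<open>Nom k\<close> holds has the theory of
    \<open>k\<close>, so \<open>k\<close> itself can replace it.\<close>
  also have "\<dots> \<longleftrightarrow> (\<exists>k. \<phi> \<in> \<Delta> n \<and> denotes k \<and> \<phi> \<in> \<Delta> k \<and> \<langle>!\<phi>\<rangle> \<alpha> \<in> \<Delta> k \<and>
      \<langle>!\<phi> \<^bold>\<and> \<^bold>[!\<phi>\<^bold>] \<^bold>\<not> Nom k\<rangle> \<psi> \<in> \<Delta> n)"
  proof -
    have "(\<exists>m. denotes m \<and> \<phi> \<in> \<Delta> m \<and> Nom k \<in> \<Delta> m \<and> \<langle>!\<phi>\<rangle> \<alpha> \<in> \<Delta> m) \<longleftrightarrow>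
        denotes k \<and> \<phi> \<in> \<Delta> k \<and> \<langle>!\<phi>\<rangle> \<alpha> \<in> \<Delta> k" for k
      by (auto simp: at_Nom intro: exI[of _ k])
    then show ?thesis by simp
  qed
  \<comment> \<open>The condition that \<open>w k\<close> differs from \<open>w n\<close> arises
    because the announced formula must hold at \<open>n\<close>, which rules out
    \<open>Nom k\<close> there.\<close>
  also have "\<dots> \<longleftrightarrow> (\<exists>k. \<phi> \<in> \<Delta> n \<and> denotes k \<and> \<phi> \<in> \<Delta> k \<and> w k \<noteq> w n \<and>
      (?M, w k \<Turnstile> \<alpha>) \<and> (remove ?M {w k}, w n \<Turnstile> \<psi>))"
    using Rem by (auto simp: remove at_Nom w_eq_iff)
  also have "\<dots> \<longleftrightarrow> \<phi> \<in> \<Delta> n \<and> (\<exists>t \<in> worlds ?M. t \<noteq> w n \<and> (?M, t \<Turnstile> \<alpha>) \<and> (remove ?M {t}, w n \<Turnstile> \<psi>))"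
    unfolding worlds_submodel_extension ex_extension by blast
  finally show ?case by simp
next
  case (Ex \<psi>)
  then have "\<langle>!\<phi>\<rangle> \<^bold>E \<psi> \<in> \<Delta> n \<longleftrightarrow> \<phi> \<in> \<Delta> n \<and>
      (\<exists>m. denotes m \<and> \<phi> \<in> \<Delta> m \<and> (submodel canonical (extension \<phi>), w m \<Turnstile> \<psi>))"
    by auto
  then show ?case
    unfolding sat.simps worlds_submodel_extension ex_extension by blast
qed

lemma canonical_sat:
  assumes "denotes n"
  shows "(canonical, w n \<Turnstile> \<psi>) \<longleftrightarrow> \<psi> \<in> \<Delta> n"
proof -
  have "submodel canonical (extension \<^bold>\<top>) = canonical"
    using is_model_canonical by (rule submodel_whole) (auto simp: extension_def canonical_def)
  then show ?thesis
    using truth[OF assms, of "\<^bold>\<top>" \<psi>] at_Iff[OF assms Truth] assms by simp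
qed

end

section \<open>Completeness: a countermodel for an underivable formula\<close>

theorem mainTheorem5:
  fixes \<phi> :: "('p :: countable, 'n :: countable) form"
  assumes "infinite (UNIV :: 'n set)"
    and "infinite (UNIV :: 'w set)"
    and "valid TYPE('w) \<phi>"
  shows "\<turnstile> \<phi>"
proof (rule ccontr)
  assume "\<not> \<turnstile> \<phi>"
  obtain i where i: "i \<notin> noms \<phi>"
    using assms(1) finite_noms ex_new_if_finite by blast
  \<comment> \<open>The falsifying world must carry a name, so the construction starts from this
    formula rather than from the negation of \<phi>. Refuting it would derive \<phi> by axiom T and
    the Name rule, as \<open>i\<close> is fresh.\<close>
  have "\<not> \<turnstile> \<^bold>\<not> \<^bold>E (Nom i \<^bold>\<and> \<^bold>\<not> \<phi>)"
  proof
    assume *: "\<turnstile> \<^bold>\<not> \<^bold>E (Nom i \<^bold>\<and> \<^bold>\<not> \<phi>)"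
    have "\<turnstile> \<^bold>E \<^bold>\<not> (Nom i \<^bold>\<rightarrow> \<phi>) \<^bold>\<rightarrow> \<^bold>E (Nom i \<^bold>\<and> \<^bold>\<not> \<phi>)"
      by (rule Ex_mono, rule Taut) (auto simp: tautology_def)
    with * have "\<turnstile> \<^bold>U (Nom i \<^bold>\<rightarrow> \<phi>)"
      by (rule MP[OF Imp_contrapos, rotated])
    then have "\<turnstile> \<phi>"
      by (rule Name[OF MP[OF U_T] i])
    with \<open>\<not> \<turnstile> \<phi>\<close> show False ..
  qed
  then obtain \<Gamma> where \<Gamma>: "mcs \<Gamma>" "\<^bold>E (Nom i \<^bold>\<and> \<^bold>\<not> \<phi>) \<in> \<Gamma>"
    and witness: "\<And>\<chi> g. \<chi> \<in> \<Gamma> \<Longrightarrow> witness \<chi> g \<Longrightarrow> \<exists>k. g k \<in> \<Gamma>"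
    by (rule witnessed_extension[OF assms(1)]) blast
  \<comment> \<open>An infinite type contains a copy of the naturals, which leaves room for one
    world per class of nominals.\<close>
  obtain f :: "nat \<Rightarrow> 'w" where f: "inj f"
    using infinite_countable_subset[OF assms(2)] by blast
  \<comment> \<open>One nominal is chosen per theory, and the choice depends on the theory alone;
    composed with the injections \<open>to_nat\<close> and \<open>f\<close> it satisfies
    \<open>w_eq_iff\<close>.\<close>
  define rep where "rep n = (SOME m. theory_at \<Gamma> m = theory_at \<Gamma> n)" for n
  have rep: "theory_at \<Gamma> (rep n) = theory_at \<Gamma> n" for n
    unfolding rep_def by (rule someI) (rule refl)
  have rep_eq_iff: "rep n = rep m \<longleftrightarrow> theory_at \<Gamma> n = theory_at \<Gamma> m" for n m
    using rep[of n] rep[of m] unfolding rep_def by metis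
  interpret mcs \<Gamma> by (rule \<Gamma>(1))
  interpret witnessed \<Gamma> "\<lambda>n. f (to_nat (rep n))"
    by unfold_locales (rule witness, assumption+, simp add: inj_eq[OF f] rep_eq_iff)
  have "denotes i"
    unfolding denotes_def
    by (rule derivable_Imp[OF Ex_mono \<Gamma>(2)]) (rule Taut, auto simp: tautology_def)
  moreover have "\<^bold>\<not> \<phi> \<in> theory_at \<Gamma> i"
    using \<Gamma>(2) by (simp add: theory_at_def)
  ultimately have "\<not> (canonical, f (to_nat (rep i)) \<Turnstile> \<phi>)"
    using canonical_sat by simp
  moreover have "f (to_nat (rep i)) \<in> worlds canonical"
    using \<open>denotes i\<close> w_in_worlds by simp
  ultimately show False
    using assms(3) is_model_canonical unfolding valid_def by blast
qed

end
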